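(* Let $\Psi_{\mathbf{G}}:\mathbf{G}\to Sym$ be the linear map sending a graph $G$ with vertex set $[n]$ to its chromatic symmetric function $\Psi_{\mathbf{G}}(G)=\sum_f\prod_{v\in[n]}x_{f(v)}$, the sum running over proper colorings $f$ of $G$. Then the linear space $\ker\Psi_{\mathbf{G}}$ is generated (spanned) by the modular relations and the isomorphism relations on graphs, and the image of $\Psi_{\mathbf{G}}$ is $Sym$.
   Context: $\mathbb{K}$ is a field of characteristic zero; $\mathbb{N}=\{1,2,\dots\}$ and $[n]=\{1,\dots,n\}$. $\mathbf{G}=\bigoplus_{n\ge 0}\mathbf{G}_n$, where $\mathbf{G}_n$ is the $\mathbb{K}$-vector space freely generated by the (simple) graphs with vertex set $[n]$. A coloring of $G$ is a function $f:V(G)\to\mathbb{N}$; it is proper if no edge is monochromatic. $Sym$ is the $\mathbb{K}$-algebra of symmetric functions in the commuting variables $x_1,x_2,\dots$. Modular relation on graphs: let $G$ be a graph with vertex set $[n]$ and $e_1,e_2,e_3$ the three edges of a triangle on three distinct vertices of $[n]$ with $e_3\in E(G)$ and $e_1,e_2\notin E(G)$. The corresponding modular relation is the element $G-G\cup\{e_1\}-G\cup\{e_2\}+G\cup\{e_1,e_2\}$ of $\mathbf{G}$, where $G\cup E$ denotes $G$ with the edges in $E$ added. Isomorphism relation on graphs: an element $G_1-G_2$ of $\mathbf{G}$, where $G_1,G_2$ are isomorphic graphs. *)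

theory Defs
  imports Complex_Main "HOL-Library.FuncSet" "HOL-Library.Poly_Mapping" "HOL-Library.Function_Algebras"
begin

definition all_edges :: "nat \<Rightarrow> nat set set" where
  "all_edges n = {e. e \<subseteq> {1..n} \<and> card e = 2}"

text \<open>A graph records its order \<open>n\<close>, so that graphs on different vertex sets \<open>{1..n}\<close> are
  different even if they have the same edges.\<close>

typedef graph = "{(n, E). E \<subseteq> all_edges n}"
  by (rule exI[of _ "(0, {})"]) simp

definition order :: "graph \<Rightarrow> nat" where
  "order G = fst (Rep_graph G)"

definition verts :: "graph \<Rightarrow> nat set" where
  "verts G = {1..order G}"

definition edges :: "graph \<Rightarrow> nat set set" where
  "edges G = snd (Rep_graph G)"

text \<open>The graph \<open>G \<union> F\<close>; meaningful only if \<open>F \<subseteq> all_edges (order G)\<close>.\<close>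

definition add_edges :: "graph \<Rightarrow> nat set set \<Rightarrow> graph" where
  "add_edges G F = Abs_graph (order G, edges G \<union> F)"

definition isomorphic :: "graph \<Rightarrow> graph \<Rightarrow> bool" where
  "isomorphic G H \<longleftrightarrow>
     (\<exists>\<pi>. bij_betw \<pi> (verts G) (verts H) \<and>
          (\<forall>u\<in>verts G. \<forall>v\<in>verts G. {u, v} \<in> edges G \<longleftrightarrow> {\<pi> u, \<pi> v} \<in> edges H))"

lemma edges_subset: "edges G \<subseteq> all_edges (order G)"
  using Rep_graph[of G] by (auto simp: edges_def order_def)

lemma
  assumes "F \<subseteq> all_edges (order G)"
  shows order_add_edges: "order (add_edges G F) = order G"
    and edges_add_edges: "edges (add_edges G F) = edges G \<union> F"
proof -
  have "Rep_graph (add_edges G F) = (order G, edges G \<union> F)"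
    unfolding add_edges_def
    by (rule Abs_graph_inverse) (use assms edges_subset in auto)
  then show "order (add_edges G F) = order G" "edges (add_edges G F) = edges G \<union> F"
    by (simp_all add: order_def edges_def)
qed

text \<open>Finitely supported functions \<open>graph \<Rightarrow>\<^sub>0 'k\<close> form the direct sum over all \<open>n\<close> of the spaces
  freely generated by the graphs of order \<open>n\<close>.\<close>

definition basis :: "graph \<Rightarrow> (graph \<Rightarrow>\<^sub>0 'k::field_char_0)" where
  "basis G = Poly_Mapping.single G 1"

definition scaleG :: "'k::field_char_0 \<Rightarrow> (graph \<Rightarrow>\<^sub>0 'k) \<Rightarrow> (graph \<Rightarrow>\<^sub>0 'k)" where
  "scaleG c x = Poly_Mapping.map ((*) c) x"

lemma lookup_scaleG: "Poly_Mapping.lookup (scaleG c x) G = c * Poly_Mapping.lookup x G"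
  by (simp add: scaleG_def Poly_Mapping.map.rep_eq when_def)

interpretation graph_space: vector_space "scaleG :: 'k::field_char_0 \<Rightarrow> _"
  by unfold_locales
    (auto intro!: poly_mapping_eqI simp: lookup_scaleG lookup_add algebra_simps)

definition modular_relations :: "(graph \<Rightarrow>\<^sub>0 'k::field_char_0) set" where
  "modular_relations =
     {basis G - basis (add_edges G {e1}) - basis (add_edges G {e2}) + basis (add_edges G {e1, e2})
       | G e1 e2 e3.
         (\<exists>a\<in>verts G. \<exists>b\<in>verts G. \<exists>c\<in>verts G. a \<noteq> b \<and> b \<noteq> c \<and> a \<noteq> c \<and>
            e1 = {a, b} \<and> e2 = {a, c} \<and> e3 = {b, c}) \<and>
         e3 \<in> edges G \<and> e1 \<notin> edges G \<and> e2 \<notin> edges G}"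

definition isomorphism_relations :: "(graph \<Rightarrow>\<^sub>0 'k::field_char_0) set" where
  "isomorphism_relations = {basis G1 - basis G2 | G1 G2. isomorphic G1 G2}"

text \<open>Colors also index the variables \<open>x\<^sub>1, x\<^sub>2, \<dots>\<close>, so both start from 1.\<close>

typedef color = "{n::nat. 1 \<le> n}"
  by (rule exI[of _ 1]) simp

text \<open>A monomial in the variables \<open>x\<^sub>1, x\<^sub>2, \<dots>\<close> is its exponent vector, and a formal power series is
  its coefficient function. Vector space operations on series are the pointwise ones; the pointwise
  product of functions is not the product of series and is not used.\<close>

type_synonym monomial = "color \<Rightarrow>\<^sub>0 nat"
type_synonym 'k series = "monomial \<Rightarrow> 'k"

definition var :: "color \<Rightarrow> monomial" where
  "var i = Poly_Mapping.single i 1"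

definition mon_degree :: "monomial \<Rightarrow> nat" where
  "mon_degree m = (\<Sum>i\<in>Poly_Mapping.keys m. Poly_Mapping.lookup m i)"

definition scaleS :: "'k::field_char_0 \<Rightarrow> 'k series \<Rightarrow> 'k series" where
  "scaleS c F = (\<lambda>m. c * F m)"

interpretation series_space: vector_space "scaleS :: 'k::field_char_0 \<Rightarrow> _"
  by unfold_locales (auto simp: scaleS_def fun_eq_iff algebra_simps)

definition Sym :: "'k::field_char_0 series set" where
  "Sym = {F. (\<exists>d. \<forall>m. F m \<noteq> 0 \<longrightarrow> mon_degree m \<le> d) \<and>
             (\<forall>\<sigma> m. bij \<sigma> \<longrightarrow> F (Poly_Mapping.map_key \<sigma> m) = F m)}"

definition proper_colorings :: "graph \<Rightarrow> (nat \<Rightarrow> color) set" where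
  "proper_colorings G =
     {f \<in> verts G \<rightarrow>\<^sub>E UNIV. \<forall>u v. {u, v} \<in> edges G \<longrightarrow> f u \<noteq> f v}"

text \<open>The exponent vector of the product of \<open>x\<^bsub>f v\<^esub>\<close> over all vertices \<open>v\<close>.\<close>

definition coloring_monomial :: "graph \<Rightarrow> (nat \<Rightarrow> color) \<Rightarrow> monomial" where
  "coloring_monomial G f = (\<Sum>v\<in>verts G. var (f v))"

text \<open>The sum over proper colorings is infinite but formal: the coefficient of a monomial is the
  number of proper colorings with that monomial, which is finite by the lemma below.\<close>

definition chromatic_function :: "graph \<Rightarrow> 'k::field_char_0 series" where
  "chromatic_function G =
     (\<lambda>m. of_nat (card {f \<in> proper_colorings G. coloring_monomial G f = m}))"

lemma finite_colorings_of_monomial: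
  "finite {f \<in> proper_colorings G. coloring_monomial G f = m}"
proof (rule finite_subset)
  show "finite (verts G \<rightarrow>\<^sub>E Poly_Mapping.keys m)"
    by (intro finite_PiE) (auto simp: verts_def)
  have "f v \<in> Poly_Mapping.keys m" if "v \<in> verts G" "coloring_monomial G f = m" for f v
  proof -
    have fin: "finite (verts G)"
      by (simp add: verts_def)
    have "Poly_Mapping.lookup m (f v)
        = (\<Sum>w\<in>verts G. Poly_Mapping.lookup (var (f w)) (f v))"
      using that(2) by (auto simp: coloring_monomial_def lookup_sum)
    also have "\<dots> \<ge> Poly_Mapping.lookup (var (f v)) (f v)"
      using fin that(1) by (intro member_le_sum) auto
    finally show ?thesis
      by (auto simp: var_def in_keys_iff)
  qed
  then show "{f \<in> proper_colorings G. coloring_monomial G f = m}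
      \<subseteq> verts G \<rightarrow>\<^sub>E Poly_Mapping.keys m"
    by (auto simp: proper_colorings_def PiE_iff extensional_def)
qed

definition chromatic_map :: "(graph \<Rightarrow>\<^sub>0 'k::field_char_0) \<Rightarrow> 'k series" where
  "chromatic_map x =
     (\<Sum>G\<in>Poly_Mapping.keys x. scaleS (Poly_Mapping.lookup x G) (chromatic_function G))"

lemma chromatic_map_basis: "chromatic_map (basis G) = chromatic_function G"
  by (simp add: chromatic_map_def basis_def)

lemma chromatic_map_superset:
  assumes "finite A" "Poly_Mapping.keys x \<subseteq> A"
  shows "chromatic_map x
    = (\<Sum>G\<in>A. scaleS (Poly_Mapping.lookup x G) (chromatic_function G))"
  unfolding chromatic_map_def
  by (rule sum.mono_neutral_left) (use assms in \<open>auto simp: in_keys_iff\<close>)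

lemma linear_chromatic_map:
  "Vector_Spaces.linear scaleG scaleS (chromatic_map :: (graph \<Rightarrow>\<^sub>0 'k::field_char_0) \<Rightarrow> _)"
proof (unfold_locales)
  fix x y :: "graph \<Rightarrow>\<^sub>0 'k"
  let ?A = "Poly_Mapping.keys x \<union> Poly_Mapping.keys y"
  show "chromatic_map (x + y) = chromatic_map x + chromatic_map y"
    using keys_add[of x y]
    by (simp add: chromatic_map_superset[of ?A] lookup_add series_space.scale_left_distrib
        sum.distrib)
next
  fix c and x :: "graph \<Rightarrow>\<^sub>0 'k"
  have "Poly_Mapping.keys (scaleG c x) \<subseteq> Poly_Mapping.keys x"
    by (auto simp: in_keys_iff lookup_scaleG)
  then show "chromatic_map (scaleG c x) = scaleS c (chromatic_map x)"
    by (simp add: chromatic_map_superset[of "Poly_Mapping.keys x"] lookup_scaleG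
        series_space.scale_sum_right)
qed

end

(* A triangle with exactly one edge in G rewrites G, modulo a modular relation, into graphs with more
   edges. This stops only when non-adjacency is an equivalence relation, that is, when G is complete
   multipartite. A proper coloring of a complete multipartite graph refines its partition into parts,
   so the chromatic symmetric functions of these graphs, one for each isomorphism type, are
   triangular with respect to the monomial symmetric functions, ordered by the number of variables.
   Triangularity gives both linear independence, hence the kernel, and spanning, hence the image. *)

theory Submission
  imports Defs
begin

section \<open>Coefficients of the chromatic symmetric function\<close>

text \<open>A triangle with exactly one edge is precisely a failure of transitivity of
  non-adjacency. The part sizes of a complete multipartite graph form a partition of n, and so does
  an exponent vector of degree n up to permutation of the variables; hence as many graphs survive
  the reduction as there are monomial symmetric functions. Partitions never occur as objects: chosen
  representatives of exponent vectors (\<open>range type_rep\<close>) replace them. As refining a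
  partition into parts only adds colors, both eliminations run upwards from few variables, and
  spanning needs only finitely many rounds because the degree bounds the number of variables. The
  diagonal coefficients are positive numbers of colorings; characteristic zero makes them invertible
  without computing them.\<close>

lemma finite_verts [simp]: "finite (verts G)"
  by (simp add: verts_def)

lemma edge_verts: "{u, v} \<in> edges G \<Longrightarrow> u \<in> verts G \<and> v \<in> verts G \<and> u \<noteq> v"
  using edges_subset[of G] by (auto simp: all_edges_def verts_def)

lemma verts_add_edges: "F \<subseteq> all_edges (order G) \<Longrightarrow> verts (add_edges G F) = verts G"
  by (simp add: verts_def order_add_edges)

lemma pair_in_all_edges:
  "u \<in> verts G \<Longrightarrow> v \<in> verts G \<Longrightarrow> u \<noteq> v \<Longrightarrow> {u, v} \<in> all_edges (order G)"
  by (auto simp: all_edges_def verts_def)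

lemma lookup_coloring_monomial:
  "Poly_Mapping.lookup (coloring_monomial G f) i = card {v \<in> verts G. f v = i}"
proof -
  have "Poly_Mapping.lookup (coloring_monomial G f) i = (\<Sum>v\<in>verts G. if f v = i then 1 else 0)"
    by (auto simp: coloring_monomial_def lookup_sum var_def lookup_single when_def intro!: sum.cong)
  also have "\<dots> = card {v \<in> verts G. f v = i}"
    by (simp add: sum.If_cases Int_def)
  finally show ?thesis .
qed

lemma keys_coloring_monomial: "Poly_Mapping.keys (coloring_monomial G f) = f ` verts G"
  by (auto simp: in_keys_iff lookup_coloring_monomial card_eq_0_iff)

lemma mon_degree_coloring_monomial: "mon_degree (coloring_monomial G f) = order G"
proof -
  have "(\<Sum>i\<in>f ` verts G. card {v \<in> verts G. f v = i}) = (\<Sum>v\<in>verts G. 1)"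
    using sum.group[of "verts G" "f ` verts G" f "\<lambda>_. 1::nat"] by simp
  then show ?thesis
    by (simp add: mon_degree_def keys_coloring_monomial lookup_coloring_monomial)
       (simp add: verts_def)
qed

lemma chromatic_function_eq_0_iff:
  "(chromatic_function G m :: 'k::field_char_0) = 0
     \<longleftrightarrow> (\<forall>f\<in>proper_colorings G. coloring_monomial G f \<noteq> m)"
  using finite_colorings_of_monomial[of G m] by (auto simp: chromatic_function_def)

lemma chromatic_function_homogeneous:
  "(chromatic_function G m :: 'k::field_char_0) \<noteq> 0 \<Longrightarrow> mon_degree m = order G"
  using mon_degree_coloring_monomial by (auto simp: chromatic_function_eq_0_iff)

text \<open>Renaming colors and relabelling vertices both act on proper colorings by bijections, so
  each invariance below reduces to giving \<open>h\<close> and its effect on monomials.\<close>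

lemma chromatic_function_transport:
  assumes "bij_betw h (proper_colorings G) (proper_colorings H)"
    and "\<And>f. f \<in> proper_colorings G \<Longrightarrow>
           coloring_monomial H (h f) = m' \<longleftrightarrow> coloring_monomial G f = m"
  shows "chromatic_function G m = (chromatic_function H m' :: 'k::field_char_0)"
proof -
  have im: "proper_colorings H = h ` proper_colorings G"
    and inj: "inj_on h (proper_colorings G)"
    using assms(1) by (simp_all add: bij_betw_def)
  have "bij_betw h {f \<in> proper_colorings G. coloring_monomial G f = m}
          {f \<in> proper_colorings H. coloring_monomial H f = m'}"
    unfolding bij_betw_def im Compr_image_eq using assms(2)
    by (auto intro: inj_on_subset[OF inj])
  then show ?thesis
    by (simp add: chromatic_function_def bij_betw_same_card)
qed

lemma map_key_eq_iff:
  assumes "bij \<sigma>"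
  shows "Poly_Mapping.map_key \<sigma> m = m' \<longleftrightarrow>
    (\<forall>i. Poly_Mapping.lookup m (\<sigma> i) = Poly_Mapping.lookup m' i)"
  using assms by (simp add: poly_mapping_eq_iff fun_eq_iff map_key.rep_eq bij_is_inj)

text \<open>Composition with \<sigma> turns the class of color i into the class of color \<sigma> i,
  so it sends colorings with monomial \<open>map_key \<sigma> m\<close> to colorings with monomial
  \<open>m\<close>.\<close>

lemma chromatic_function_symmetric:
  assumes "bij \<sigma>"
  shows "chromatic_function G (Poly_Mapping.map_key \<sigma> m)
     = (chromatic_function G m :: 'k::field_char_0)"
proof (rule chromatic_function_transport)
  let ?h = "\<lambda>\<tau> f. restrict (\<tau> \<circ> f) (verts G)"
  have inj: "\<sigma> x = \<sigma> y \<longleftrightarrow> x = y" for x y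
    using assms by (auto simp: bij_def inj_def)
  have inv: "inv \<sigma> (\<sigma> x) = x" "\<sigma> (inv \<sigma> x) = x" for x
    using assms by (simp_all add: bij_def surj_f_inv_f)
  have inj': "inv \<sigma> x = inv \<sigma> y \<longleftrightarrow> x = y" for x y
    by (metis inv)
  show "bij_betw (?h \<sigma>) (proper_colorings G) (proper_colorings G)"
  proof (rule bij_betw_byWitness[where f' = "?h (inv \<sigma>)"])
    show "\<forall>f\<in>proper_colorings G. ?h (inv \<sigma>) (?h \<sigma> f) = f"
      "\<forall>f\<in>proper_colorings G. ?h \<sigma> (?h (inv \<sigma>) f) = f"
      by (auto simp: proper_colorings_def fun_eq_iff inv restrict_def PiE_iff extensional_def)
    show "?h \<sigma> ` proper_colorings G \<subseteq> proper_colorings G"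
      "?h (inv \<sigma>) ` proper_colorings G \<subseteq> proper_colorings G"
      using edge_verts[of _ _ G] by (auto simp: proper_colorings_def inj inj')
  qed
  fix f assume "f \<in> proper_colorings G"
  have count: "Poly_Mapping.lookup (coloring_monomial G (?h \<sigma> f)) (\<sigma> i)
     = Poly_Mapping.lookup (coloring_monomial G f) i" for i
    by (auto simp: lookup_coloring_monomial inj intro!: arg_cong[where f = card])
  have "coloring_monomial G (?h \<sigma> f) = m \<longleftrightarrow>
     (\<forall>i. Poly_Mapping.lookup (coloring_monomial G (?h \<sigma> f)) (\<sigma> i) = Poly_Mapping.lookup m (\<sigma> i))"
    by (metis inv(2) poly_mapping_eqI)
  also have "\<dots> \<longleftrightarrow> coloring_monomial G f = Poly_Mapping.map_key \<sigma> m"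
    unfolding count using map_key_eq_iff[OF assms, of m "coloring_monomial G f"] by auto
  finally show "coloring_monomial G (?h \<sigma> f) = m \<longleftrightarrow>
      coloring_monomial G f = Poly_Mapping.map_key \<sigma> m" .
qed

text \<open>Colorings are carried along the inverse of the isomorphism. This preserves the sizes of
  the color classes, on which alone the monomial depends.\<close>

lemma chromatic_function_isomorphic:
  assumes "isomorphic G H"
  shows "chromatic_function G = (chromatic_function H :: 'k::field_char_0 series)"
proof
  fix m
  obtain \<pi> where bij: "bij_betw \<pi> (verts G) (verts H)"
    and edge: "\<And>u v. u \<in> verts G \<Longrightarrow> v \<in> verts G \<Longrightarrow> {u, v} \<in> edges G \<longleftrightarrow> {\<pi> u, \<pi> v} \<in> edges H"
    using assms by (auto simp: isomorphic_def)
  define \<rho> where "\<rho> = inv_into (verts G) \<pi>"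
  have inv: "\<rho> (\<pi> u) = u" if "u \<in> verts G" for u
    using that bij by (simp add: \<rho>_def bij_betw_inv_into_left)
  have inv': "\<pi> (\<rho> v) = v" if "v \<in> verts H" for v
    using that bij by (simp add: \<rho>_def bij_betw_inv_into_right)
  have mem: "\<pi> u \<in> verts H" if "u \<in> verts G" for u
    using that bij by (auto simp: bij_betw_def)
  have mem': "\<rho> v \<in> verts G" if "v \<in> verts H" for v
    using that bij by (auto simp: \<rho>_def bij_betw_def inv_into_into)
  have edge': "{\<rho> u, \<rho> v} \<in> edges G \<longleftrightarrow> {u, v} \<in> edges H"
    if "u \<in> verts H" "v \<in> verts H" for u v
    using edge[of "\<rho> u" "\<rho> v"] that mem' inv' by simp
  show "chromatic_function G m = (chromatic_function H m :: 'k)"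
  proof (rule chromatic_function_transport)
    show "bij_betw (\<lambda>f. restrict (f \<circ> \<rho>) (verts H)) (proper_colorings G) (proper_colorings H)"
    proof (rule bij_betw_byWitness[where f' = "\<lambda>f. restrict (f \<circ> \<pi>) (verts G)"])
      show "\<forall>f\<in>proper_colorings G. restrict (restrict (f \<circ> \<rho>) (verts H) \<circ> \<pi>) (verts G) = f"
        by (auto simp: proper_colorings_def fun_eq_iff inv mem restrict_def PiE_iff extensional_def)
      show "\<forall>f\<in>proper_colorings H. restrict (restrict (f \<circ> \<pi>) (verts G) \<circ> \<rho>) (verts H) = f"
        by (auto simp: proper_colorings_def fun_eq_iff inv' mem' restrict_def PiE_iff extensional_def)
      show "(\<lambda>f. restrict (f \<circ> \<rho>) (verts H)) ` proper_colorings G \<subseteq> proper_colorings H"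
      proof (safe, unfold proper_colorings_def mem_Collect_eq, safe)
        fix f u v
        assume "\<forall>u v. {u, v} \<in> edges G \<longrightarrow> f u \<noteq> f v" "{u, v} \<in> edges H"
          and "restrict (f \<circ> \<rho>) (verts H) u = restrict (f \<circ> \<rho>) (verts H) v"
        then show False
          using edge'[of u v] edge_verts[of u v H] by auto
      qed auto
      show "(\<lambda>f. restrict (f \<circ> \<pi>) (verts G)) ` proper_colorings H \<subseteq> proper_colorings G"
      proof (safe, unfold proper_colorings_def mem_Collect_eq, safe)
        fix f u v
        assume "\<forall>u v. {u, v} \<in> edges H \<longrightarrow> f u \<noteq> f v" "{u, v} \<in> edges G"
          and "restrict (f \<circ> \<pi>) (verts G) u = restrict (f \<circ> \<pi>) (verts G) v"
        then show False
          using edge[of u v] edge_verts[of u v G] by auto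
      qed auto
    qed
    fix f :: "nat \<Rightarrow> color"
    have "bij_betw \<pi> {v \<in> verts G. f v = i} {v \<in> verts H. restrict (f \<circ> \<rho>) (verts H) v = i}" for i
      by (rule bij_betw_byWitness[where f' = \<rho>]) (auto simp: inv inv' mem mem')
    from bij_betw_same_card[OF this]
    have "coloring_monomial H (restrict (f \<circ> \<rho>) (verts H)) = coloring_monomial G f"
      by (intro poly_mapping_eqI) (simp only: lookup_coloring_monomial)
    then show "coloring_monomial H (restrict (f \<circ> \<rho>) (verts H)) = m \<longleftrightarrow> coloring_monomial G f = m"
      by simp
  qed
qed

lemma proper_colorings_add_edges:
  assumes "F \<subseteq> all_edges (order G)"
  shows "proper_colorings (add_edges G F)
     = {f \<in> proper_colorings G. \<forall>u v. {u, v} \<in> F \<longrightarrow> f u \<noteq> f v}"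
  using assms by (auto simp: proper_colorings_def verts_add_edges edges_add_edges)

text \<open>By inclusion-exclusion the alternating sum counts the proper colorings of \<open>G\<close> that are
  monochromatic on both \<open>ab\<close> and \<open>ac\<close>; there are none, as \<open>bc\<close> is an edge.\<close>

lemma chromatic_function_modular:
  assumes "a \<in> verts G" "b \<in> verts G" "c \<in> verts G" "a \<noteq> b" "a \<noteq> c" "{b, c} \<in> edges G"
  shows "chromatic_function G m + chromatic_function (add_edges G {{a, b}, {a, c}}) m
     = (chromatic_function (add_edges G {{a, b}}) m + chromatic_function (add_edges G {{a, c}}) m
        :: 'k::field_char_0)"
proof -
  have ab: "{a, b} \<in> all_edges (order G)" and ac: "{a, c} \<in> all_edges (order G)"
    using assms by (auto intro: pair_in_all_edges)
  have mon: "coloring_monomial (add_edges G F) = coloring_monomial G"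
    if "F \<subseteq> all_edges (order G)" for F
    using that by (simp add: fun_eq_iff coloring_monomial_def verts_add_edges)
  have bad: "(\<forall>u v. {u, v} \<in> {{a, b}} \<longrightarrow> f u \<noteq> f v) \<longleftrightarrow> f a \<noteq> f b"
    "(\<forall>u v. {u, v} \<in> {{a, c}} \<longrightarrow> f u \<noteq> f v) \<longleftrightarrow> f a \<noteq> f c"
    "(\<forall>u v. {u, v} \<in> {{a, b}, {a, c}} \<longrightarrow> f u \<noteq> f v) \<longleftrightarrow> f a \<noteq> f b \<and> f a \<noteq> f c"
    for f :: "nat \<Rightarrow> color"
    by (auto simp: doubleton_eq_iff)
  have col: "proper_colorings (add_edges G {{a, b}}) = {f \<in> proper_colorings G. f a \<noteq> f b}"
    "proper_colorings (add_edges G {{a, c}}) = {f \<in> proper_colorings G. f a \<noteq> f c}"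
    "proper_colorings (add_edges G {{a, b}, {a, c}})
       = {f \<in> proper_colorings G. f a \<noteq> f b \<and> f a \<noteq> f c}"
    using ab ac
    by (subst proper_colorings_add_edges; simp only: bad insert_subset empty_subsetI simp_thms)+
  have bc: "f b \<noteq> f c" if "f \<in> proper_colorings G" for f
    using assms(6) that by (simp add: proper_colorings_def)
  define P A B where "P = {f \<in> proper_colorings G. coloring_monomial G f = m}"
    and "A = {f \<in> P. f a \<noteq> f b}" and "B = {f \<in> P. f a \<noteq> f c}"
  have "P = A \<union> B"
    using bc unfolding A_def B_def P_def by fastforce
  moreover have "finite A" "finite B"
    using finite_colorings_of_monomial[of G m] by (auto simp: A_def B_def P_def elim!: rev_finite_subset)
  ultimately have "card P + card (A \<inter> B) = card A + card B"
    using card_Un_Int[of A B] by simp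
  moreover have "A = {f \<in> proper_colorings (add_edges G {{a, b}}).
      coloring_monomial (add_edges G {{a, b}}) f = m}"
    using ab by (auto simp: A_def P_def col mon)
  moreover have "B = {f \<in> proper_colorings (add_edges G {{a, c}}).
      coloring_monomial (add_edges G {{a, c}}) f = m}"
    using ac by (auto simp: B_def P_def col mon)
  moreover have "A \<inter> B = {f \<in> proper_colorings (add_edges G {{a, b}, {a, c}}).
      coloring_monomial (add_edges G {{a, b}, {a, c}}) f = m}"
    using ab ac by (auto simp: A_def B_def P_def col mon)
  ultimately show ?thesis
    by (simp add: chromatic_function_def flip: P_def of_nat_add)
qed

section \<open>Exponent vectors up to permutation of the variables\<close>

text \<open>The classes correspond to integer partitions; their indicator functions are the monomial
  symmetric functions.\<close>

definition same_type :: "monomial \<Rightarrow> monomial \<Rightarrow> bool" where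
  "same_type m m' \<longleftrightarrow> (\<exists>\<sigma>. bij \<sigma> \<and> Poly_Mapping.map_key \<sigma> m = m')"

lemma same_type_iff:
  "same_type m m' \<longleftrightarrow> (\<exists>\<sigma>. bij \<sigma> \<and> (\<forall>i. Poly_Mapping.lookup m (\<sigma> i) = Poly_Mapping.lookup m' i))"
  unfolding same_type_def using map_key_eq_iff by blast

lemma same_type_refl: "same_type m m"
  unfolding same_type_iff by (rule exI[of _ id]) simp

lemma same_type_sym: "same_type m m' \<Longrightarrow> same_type m' m"
  unfolding same_type_iff by (metis bij_imp_bij_inv bij_inv_eq_iff)

lemma same_type_trans: "same_type m m' \<Longrightarrow> same_type m' m'' \<Longrightarrow> same_type m m''"
  unfolding same_type_iff by (metis bij_comp comp_apply)

lemma Sym_same_type: "F \<in> Sym \<Longrightarrow> same_type m m' \<Longrightarrow> F m = F m'"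
  by (auto simp: Sym_def same_type_def)

lemma same_type_card_keys:
  assumes "same_type m m'"
  shows "card (Poly_Mapping.keys m) = card (Poly_Mapping.keys m')"
proof -
  obtain \<sigma> where \<sigma>: "bij \<sigma>" "\<And>i. Poly_Mapping.lookup m (\<sigma> i) = Poly_Mapping.lookup m' i"
    using assms by (auto simp: same_type_iff)
  have "\<sigma> ` Poly_Mapping.keys m' = Poly_Mapping.keys m"
  proof
    show "Poly_Mapping.keys m \<subseteq> \<sigma> ` Poly_Mapping.keys m'"
    proof
      fix i assume "i \<in> Poly_Mapping.keys m"
      then have "inv \<sigma> i \<in> Poly_Mapping.keys m'" "i = \<sigma> (inv \<sigma> i)"
        using \<sigma> by (auto simp: in_keys_iff bij_is_surj surj_f_inv_f simp flip: \<sigma>(2))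
      then show "i \<in> \<sigma> ` Poly_Mapping.keys m'" by blast
    qed
  qed (auto simp: in_keys_iff \<sigma>(2))
  then show ?thesis
    using \<sigma>(1) by (metis bij_is_inj card_image inj_on_subset subset_UNIV)
qed

text \<open>The predicate \<open>same_type m\<close> is the same function for all \<open>m\<close>
  of one orbit, so the choice depends on the orbit alone and the range is a transversal.\<close>

definition type_rep :: "monomial \<Rightarrow> monomial" where
  "type_rep m = (SOME m'. same_type m m')"

lemma same_type_rep: "same_type m (type_rep m)"
  unfolding type_rep_def by (rule someI[of _ m]) (rule same_type_refl)

lemma type_rep_eq:
  assumes "same_type m m'"
  shows "type_rep m = type_rep m'"
proof -
  have "same_type m = same_type m'"
    using assms by (auto simp: fun_eq_iff intro: same_type_trans same_type_sym)
  then show ?thesis by (simp add: type_rep_def)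
qed

lemma range_type_rep_unique:
  "m \<in> range type_rep \<Longrightarrow> m' \<in> range type_rep \<Longrightarrow> same_type m m' \<Longrightarrow> m = m'"
  by (metis imageE type_rep_eq same_type_rep)

text \<open>Counting colors matches only two finite supports, while \<open>same_type\<close> asks
  for a permutation of all colors. The remainders of \<open>A \<union> B\<close> outside
  \<open>A\<close> and outside \<open>B\<close> have equal size, and all other points can stay
  fixed.\<close>

lemma bij_extending_bij_betw:
  assumes "finite (A :: 'a set)" "bij_betw g A (B :: 'a set)"
  shows "\<exists>\<sigma>. bij \<sigma> \<and> (\<forall>x\<in>A. \<sigma> x = g x)"
proof -
  have fB: "finite B" and cAB: "card A = card B"
    using assms by (auto simp: bij_betw_finite bij_betw_same_card)
  have "card (A \<union> B - A) = card (A \<union> B - B)"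
    using assms(1) fB cAB by (simp add: card_Diff_subset)
  then obtain h where h: "bij_betw h (A \<union> B - A) (A \<union> B - B)"
    using assms(1) fB by (meson finite_Diff finite_UnI finite_same_card_bij)
  define \<sigma> where "\<sigma> x = (if x \<in> A then g x else if x \<in> B then h x else x)" for x
  have "bij_betw \<sigma> A B"
    using assms(2) by (subst bij_betw_cong[of _ _ g]) (auto simp: \<sigma>_def)
  moreover have "bij_betw \<sigma> (A \<union> B - A) (A \<union> B - B)"
    using h by (subst bij_betw_cong[of _ _ h]) (auto simp: \<sigma>_def)
  ultimately have "bij_betw \<sigma> (A \<union> (A \<union> B - A)) (B \<union> (A \<union> B - B))"
    by (rule bij_betw_combine) auto
  moreover have "bij_betw \<sigma> (- (A \<union> B)) (- (A \<union> B))"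
    by (subst bij_betw_cong[of _ _ id]) (auto simp: \<sigma>_def)
  ultimately have "bij_betw \<sigma> (A \<union> (A \<union> B - A) \<union> - (A \<union> B)) (B \<union> (A \<union> B - B) \<union> - (A \<union> B))"
    by (rule bij_betw_combine) auto
  moreover have "A \<union> (A \<union> B - A) \<union> - (A \<union> B) = UNIV" "B \<union> (A \<union> B - B) \<union> - (A \<union> B) = UNIV"
    by auto
  ultimately have "bij \<sigma>"
    by simp
  then show ?thesis by (auto simp: \<sigma>_def)
qed

section \<open>Complete multipartite graphs\<close>

text \<open>The parts are the fibres of \<open>c\<close>. For colors as values, \<open>c\<close> is
  thus itself a proper coloring, and its monomial records the part sizes.\<close>

definition multipartite :: "nat \<Rightarrow> (nat \<Rightarrow> 'c) \<Rightarrow> graph" where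
  "multipartite n c = Abs_graph (n, {e \<in> all_edges n. \<exists>u\<in>e. \<exists>v\<in>e. c u \<noteq> c v})"

lemma Rep_multipartite:
  "Rep_graph (multipartite n c) = (n, {e \<in> all_edges n. \<exists>u\<in>e. \<exists>v\<in>e. c u \<noteq> c v})"
  unfolding multipartite_def by (rule Abs_graph_inverse) auto

lemma verts_multipartite [simp]: "verts (multipartite n c) = {1..n}"
  by (simp add: verts_def order_def Rep_multipartite)

lemma edge_multipartite_iff:
  "{u, v} \<in> edges (multipartite n c) \<longleftrightarrow> u \<in> {1..n} \<and> v \<in> {1..n} \<and> c u \<noteq> c v"
  by (cases "u = v") (auto simp: edges_def Rep_multipartite all_edges_def)

text \<open>Parts of equal size can be matched; any bijections between matched parts glue to an
  isomorphism, as adjacency depends only on the parts.\<close>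

lemma isomorphic_multipartite:
  fixes c c' :: "nat \<Rightarrow> color"
  assumes "same_type (coloring_monomial (multipartite n c) c)
                     (coloring_monomial (multipartite n' c') c')"
  shows "isomorphic (multipartite n c) (multipartite n' c')"
proof -
  obtain \<sigma> where \<sigma>: "bij \<sigma>"
    and card: "\<And>i. card {v \<in> {1..n}. c v = \<sigma> i} = card {v \<in> {1..n'}. c' v = i}"
    using assms by (auto simp: same_type_iff lookup_coloring_monomial)
  have "\<exists>h. bij_betw h {v \<in> {1..n}. c v = \<sigma> i} {v \<in> {1..n'}. c' v = i}" for i
    by (rule finite_same_card_bij) (auto simp only: card, auto)
  then obtain h where h: "\<And>i. bij_betw (h i) {v \<in> {1..n}. c v = \<sigma> i} {v \<in> {1..n'}. c' v = i}"
    by metis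
  have inv: "\<sigma> (inv \<sigma> i) = i" "inv \<sigma> (\<sigma> i) = i" for i
    using \<sigma> by (simp_all add: bij_def surj_f_inv_f)
  \<comment> \<open>Part \<sigma> i of the first graph is matched with part i of the second, so part
    \<open>c v\<close> has index \<open>inv \<sigma> (c v)\<close>.\<close>
  define \<pi> where "\<pi> v = h (inv \<sigma> (c v)) v" for v
  have \<pi>: "\<pi> v \<in> {1..n'}" "c' (\<pi> v) = inv \<sigma> (c v)" if "v \<in> {1..n}" for v
    using bij_betwE[OF h[of "inv \<sigma> (c v)"]] that by (auto simp: \<pi>_def inv)
  have "bij_betw \<pi> {1..n} {1..n'}"
    unfolding bij_betw_def
  proof
    show "inj_on \<pi> {1..n}"
    proof (rule inj_onI)
      fix u v assume uv: "u \<in> {1..n}" "v \<in> {1..n}" "\<pi> u = \<pi> v"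
      then have "c u = c v" by (metis \<pi>(2) inv(1))
      then show "u = v"
        using uv bij_betw_imp_inj_on[OF h[of "inv \<sigma> (c v)"]]
        by (auto simp: \<pi>_def inv inj_on_def)
    qed
    show "\<pi> ` {1..n} = {1..n'}"
    proof
      show "\<pi> ` {1..n} \<subseteq> {1..n'}" using \<pi>(1) by blast
      show "{1..n'} \<subseteq> \<pi> ` {1..n}"
      proof
        fix w assume "w \<in> {1..n'}"
        then have "w \<in> h (c' w) ` {v \<in> {1..n}. c v = \<sigma> (c' w)}"
          using bij_betw_imp_surj_on[OF h[of "c' w"]] by auto
        then obtain v where "v \<in> {1..n}" "c v = \<sigma> (c' w)" "w = h (c' w) v" by blast
        then have "w = \<pi> v" by (simp add: \<pi>_def inv)
        with \<open>v \<in> {1..n}\<close> show "w \<in> \<pi> ` {1..n}" by blast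
      qed
    qed
  qed
  moreover have "{u, v} \<in> edges (multipartite n c) \<longleftrightarrow> {\<pi> u, \<pi> v} \<in> edges (multipartite n' c')"
    if "u \<in> {1..n}" "v \<in> {1..n}" for u v
    using that \<pi> by (simp only: edge_multipartite_iff) (metis inv(1))
  ultimately show ?thesis
    unfolding isomorphic_def verts_multipartite by blast
qed

lemma exists_coloring_with_monomial:
  "\<exists>n (c :: nat \<Rightarrow> color). coloring_monomial (multipartite n c) c = m"
proof -
  \<comment> \<open>One vertex for each unit of exponent: the pairs (i, j) with j below the exponent
    of i are numbered from 1 and colored by i.\<close>
  define S where "S = Sigma (Poly_Mapping.keys m) (\<lambda>i. {..<Poly_Mapping.lookup m i})"
  have "finite S" by (simp add: S_def)
  then obtain h where h: "bij_betw h {1..card S} S"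
    using ex_bij_betw_nat_finite_1 by blast
  let ?c = "fst \<circ> h"
  have "card {v \<in> {1..card S}. ?c v = i} = Poly_Mapping.lookup m i" for i
  proof -
    have img: "S = h ` {1..card S}" and "inj_on h {1..card S}"
      using h by (simp_all add: bij_betw_def)
    then have "inj_on h {v \<in> {1..card S}. ?c v = i}"
      by (elim inj_on_subset) blast
    moreover have "h ` {v \<in> {1..card S}. ?c v = i} = {p \<in> S. fst p = i}"
      by (subst (2) img) (simp only: Compr_image_eq comp_apply)
    ultimately have "bij_betw h {v \<in> {1..card S}. ?c v = i} {p \<in> S. fst p = i}"
      by (simp only: bij_betw_def)
    moreover have "{p \<in> S. fst p = i} = {i} \<times> {..<Poly_Mapping.lookup m i}"
      by (auto simp: S_def in_keys_iff)
    ultimately show ?thesis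
      by (simp add: bij_betw_same_card)
  qed
  then have "coloring_monomial (multipartite (card S) ?c) ?c = m"
    by (intro poly_mapping_eqI) (simp only: lookup_coloring_monomial verts_multipartite)
  then show ?thesis by blast
qed

lemma restrict_in_proper_colorings_multipartite:
  "restrict c {1..n} \<in> proper_colorings (multipartite n c)"
  by (auto simp: proper_colorings_def edge_multipartite_iff)

text \<open>The color classes of a proper coloring \<open>f\<close> refine those of \<open>c\<close>, so that \<open>f\<close> uses at least as
  many colors as \<open>c\<close>, with equality only if the color classes coincide.\<close>

lemma proper_coloring_multipartite:
  fixes n and c :: "nat \<Rightarrow> color"
  defines "G \<equiv> multipartite n c"
  defines "m \<equiv> coloring_monomial G c"
  assumes "f \<in> proper_colorings G" "coloring_monomial G f = m'"
  shows "card (Poly_Mapping.keys m) \<le> card (Poly_Mapping.keys m')"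
    and "card (Poly_Mapping.keys m) = card (Poly_Mapping.keys m') \<Longrightarrow> same_type m m'"
proof -
  have keys: "Poly_Mapping.keys m = c ` {1..n}" "Poly_Mapping.keys m' = f ` {1..n}"
    using assms(4) by (auto simp: m_def G_def keys_coloring_monomial)
  have refine: "c u = c v" if "u \<in> {1..n}" "v \<in> {1..n}" "f u = f v" for u v
    using assms(3) that edge_multipartite_iff[of u v n c] by (auto simp: proper_colorings_def G_def)
  \<comment> \<open>Coarsens the colors of \<open>f\<close> to those of \<open>c\<close>; by
    \<open>refine\<close> the chosen preimage does not matter.\<close>
  define g where "g = c \<circ> inv_into {1..n} f"
  have g: "g (f v) = c v" if "v \<in> {1..n}" for v
    unfolding g_def comp_apply
    by (rule refine) (use that in \<open>auto intro!: inv_into_into f_inv_into_f simp del: atLeastAtMost_iff\<close>)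
  have img: "g ` Poly_Mapping.keys m' = Poly_Mapping.keys m"
    unfolding keys image_image using g by (intro image_cong) auto
  show "card (Poly_Mapping.keys m) \<le> card (Poly_Mapping.keys m')"
    unfolding img[symmetric] by (rule card_image_le) simp
  assume "card (Poly_Mapping.keys m) = card (Poly_Mapping.keys m')"
  \<comment> \<open>A surjection between finite sets of equal size is injective, so no part is split
    by \<open>f\<close>.\<close>
  then have "inj_on g (Poly_Mapping.keys m')"
    by (intro eq_card_imp_inj_on) (simp_all add: img)
  then have bij: "bij_betw g (Poly_Mapping.keys m') (Poly_Mapping.keys m)"
    using img by (simp add: bij_betw_def)
  then obtain \<sigma> where \<sigma>: "bij \<sigma>" "\<And>i. i \<in> Poly_Mapping.keys m' \<Longrightarrow> \<sigma> i = g i"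
    using bij_extending_bij_betw by (metis finite_keys)
  have "Poly_Mapping.lookup m (\<sigma> i) = Poly_Mapping.lookup m' i" for i
  proof (cases "i \<in> Poly_Mapping.keys m'")
    case True
    then have "c v = \<sigma> i \<longleftrightarrow> f v = i" if "v \<in> {1..n}" for v
      using that g \<sigma> keys bij by (metis bij_is_inj imageI injD)
    then have "{v \<in> {1..n}. c v = \<sigma> i} = {v \<in> {1..n}. f v = i}" by blast
    then show ?thesis
      unfolding m_def assms(4)[symmetric] lookup_coloring_monomial G_def verts_multipartite
      by simp
  next
    case False
    have "\<sigma> ` Poly_Mapping.keys m' = Poly_Mapping.keys m"
      using img \<sigma>(2) by (metis image_cong)
    then have "\<sigma> i \<notin> Poly_Mapping.keys m"
      using False \<sigma>(1) by (metis bij_is_inj inj_image_mem_iff)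
    with False show ?thesis by (simp add: in_keys_iff)
  qed
  then show "same_type m m'"
    using \<sigma>(1) by (auto simp: same_type_iff)
qed

definition type_graph :: "monomial \<Rightarrow> graph" where
  "type_graph m = (SOME G. \<exists>n c. G = multipartite n c \<and> coloring_monomial G c = m)"

lemma type_graphE:
  obtains n and c :: "nat \<Rightarrow> color"
  where "type_graph m = multipartite n c" "coloring_monomial (multipartite n c) c = m"
proof -
  have "\<exists>G n (c :: nat \<Rightarrow> color). G = multipartite n c \<and> coloring_monomial G c = m"
    using exists_coloring_with_monomial by blast
  then have "\<exists>n c. type_graph m = multipartite n c \<and> coloring_monomial (type_graph m) c = m"
    unfolding type_graph_def by (rule someI_ex)
  then show ?thesis using that by auto
qed

lemma order_type_graph: "order (type_graph m) = mon_degree m"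
  by (metis type_graphE mon_degree_coloring_monomial)

text \<open>The witness is the coloring \<open>c\<close> that defines the parts, restricted to the
  vertices.\<close>

lemma chromatic_function_type_graph_self:
  "(chromatic_function (type_graph m) m :: 'k::field_char_0) \<noteq> 0"
proof -
  obtain n and c :: "nat \<Rightarrow> color"
    where c: "type_graph m = multipartite n c" "coloring_monomial (multipartite n c) c = m"
    by (rule type_graphE)
  have "coloring_monomial (multipartite n c) (restrict c {1..n}) = m"
    using c(2) by (simp add: coloring_monomial_def)
  then show ?thesis
    unfolding chromatic_function_eq_0_iff c(1)
    using restrict_in_proper_colorings_multipartite by blast
qed

text \<open>No monomial of this function has fewer variables than \<open>m\<close>, so the second
  hypothesis forces equality, where the color classes are the parts.\<close>

lemma chromatic_function_type_graph_triangular: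
  assumes "(chromatic_function (type_graph m) m' :: 'k::field_char_0) \<noteq> 0"
    and "card (Poly_Mapping.keys m') \<le> card (Poly_Mapping.keys m)"
  shows "same_type m m'"
proof -
  obtain n and c :: "nat \<Rightarrow> color"
    where c: "type_graph m = multipartite n c" "coloring_monomial (multipartite n c) c = m"
    by (rule type_graphE)
  obtain f where f: "f \<in> proper_colorings (multipartite n c)"
    "coloring_monomial (multipartite n c) f = m'"
    using assms(1) by (auto simp: chromatic_function_eq_0_iff c(1))
  show ?thesis
    using proper_coloring_multipartite[OF f] assms(2) unfolding c(2) by simp
qed

section \<open>Reduction modulo the relations\<close>

text \<open>The hypothesis excludes triangles with exactly one edge. Non-adjacency is reflexive and
  symmetric anyway, so its classes can serve as parts.\<close>

lemma eq_multipartite_if_nonadjacency_transitive: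
  assumes "\<And>a b c. \<lbrakk>a \<in> verts G; b \<in> verts G; c \<in> verts G; a \<noteq> b; a \<noteq> c;
      {b, c} \<in> edges G; {a, b} \<notin> edges G\<rbrakk> \<Longrightarrow> {a, c} \<in> edges G"
  shows "\<exists>c :: nat \<Rightarrow> color. G = multipartite (order G) c"
proof -
  \<comment> \<open>The least non-neighbor of \<open>v\<close>, possibly \<open>v\<close> itself,
    represents the class. Vertices are at least 1, so \<open>Abs_color\<close> is injective on
    them.\<close>
  define r where "r v = Min {u \<in> verts G. {u, v} \<notin> edges G}" for v
  define c where "c v = Abs_color (r v)" for v
  have r: "r v \<in> verts G" "{r v, v} \<notin> edges G" if "v \<in> verts G" for v
  proof -
    have "v \<in> {u \<in> verts G. {u, v} \<notin> edges G}"
      using that edge_verts[of v v G] by auto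
    then have "r v \<in> {u \<in> verts G. {u, v} \<notin> edges G}"
      unfolding r_def by (intro Min_in) auto
    then show "r v \<in> verts G" "{r v, v} \<notin> edges G" by auto
  qed
  have tr: "{u, w} \<notin> edges G"
    if "u \<in> verts G" "v \<in> verts G" "w \<in> verts G" "{u, v} \<notin> edges G" "{v, w} \<notin> edges G" for u v w
    using assms[of v u w] that by (cases "v = u"; cases "v = w") (auto simp: insert_commute)
  have c_eq: "c u = c v \<longleftrightarrow> {u, v} \<notin> edges G" if "u \<in> verts G" "v \<in> verts G" for u v
  proof -
    have "c u = c v \<longleftrightarrow> r u = r v"
      using r(1)[OF that(1)] r(1)[OF that(2)] unfolding c_def
      by (subst Abs_color_inject) (auto simp: verts_def)
    also have "\<dots> \<longleftrightarrow> {u, v} \<notin> edges G"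
    proof
      assume "r u = r v"
      then show "{u, v} \<notin> edges G"
        using r[OF that(1)] r[OF that(2)] tr[of u "r u" v] that by (auto simp: insert_commute)
    next
      assume "{u, v} \<notin> edges G"
      then have "{w \<in> verts G. {w, u} \<notin> edges G} = {w \<in> verts G. {w, v} \<notin> edges G}"
        using that tr[of _ u v] tr[of _ v u] by (auto simp: insert_commute)
      then show "r u = r v" by (simp add: r_def)
    qed
    finally show ?thesis .
  qed
  have "edges G = {e \<in> all_edges (order G). \<exists>u\<in>e. \<exists>v\<in>e. c u \<noteq> c v}"
  proof (intro set_eqI)
    fix e
    show "e \<in> edges G \<longleftrightarrow> e \<in> {e \<in> all_edges (order G). \<exists>u\<in>e. \<exists>v\<in>e. c u \<noteq> c v}"
    proof (cases "e \<in> all_edges (order G)")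
      case True
      then obtain u v where e: "e = {u, v}" and uv: "u \<in> verts G" "v \<in> verts G"
        by (auto simp: all_edges_def verts_def card_2_iff)
      show ?thesis using True c_eq[OF uv] unfolding e by auto
    next
      case False
      then show ?thesis using edges_subset[of G] by auto
    qed
  qed
  then have "Rep_graph G = Rep_graph (multipartite (order G) c)"
    by (simp add: Rep_multipartite prod_eq_iff order_def edges_def)
  then show ?thesis by (auto simp: Rep_graph_inject)
qed

lemma sum_fun_apply: "(\<Sum>i\<in>I. f i) x = (\<Sum>i\<in>I. f i x)"
  by (induction I rule: infinite_finite_induct) auto

abbreviation relations :: "(graph \<Rightarrow>\<^sub>0 'k::field_char_0) set" where
  "relations \<equiv> modular_relations \<union> isomorphism_relations"

text \<open>Induction on the number of missing edges. The multipartite generators are indexed by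
  representatives only, because independence needs one graph for each isomorphism type.\<close>

lemma basis_reduction:
  "(basis G :: graph \<Rightarrow>\<^sub>0 'k::field_char_0)
     \<in> graph_space.span (relations \<union> (\<lambda>m. basis (type_graph m)) ` range type_rep)"
proof (induction "card (all_edges (order G) - edges G)" arbitrary: G rule: less_induct)
  case less
  let ?S = "graph_space.span (relations \<union> (\<lambda>m. basis (type_graph m)) ` range type_rep)
    :: (graph \<Rightarrow>\<^sub>0 'k) set"
  show ?case
  proof (cases "\<exists>a b c. a \<in> verts G \<and> b \<in> verts G \<and> c \<in> verts G \<and> a \<noteq> b \<and> a \<noteq> c \<and>
      {b, c} \<in> edges G \<and> {a, b} \<notin> edges G \<and> {a, c} \<notin> edges G")
    case True
    then obtain a b c where abc: "a \<in> verts G" "b \<in> verts G" "c \<in> verts G" "a \<noteq> b" "a \<noteq> c"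
      "{b, c} \<in> edges G" "{a, b} \<notin> edges G" "{a, c} \<notin> edges G" by blast
    have "b \<noteq> c" using abc(6) edge_verts by blast
    have smaller: "basis (add_edges G F) \<in> ?S"
      if F: "F \<subseteq> all_edges (order G)" "\<not> F \<subseteq> edges G" for F
    proof (rule less)
      have "finite (all_edges (order G))" by (simp add: all_edges_def)
      moreover have "all_edges (order G) - (edges G \<union> F) \<subset> all_edges (order G) - edges G"
        using F by blast
      ultimately show "card (all_edges (order (add_edges G F)) - edges (add_edges G F))
          < card (all_edges (order G) - edges G)"
        using F(1) by (simp add: order_add_edges edges_add_edges psubset_card_mono)
    qed
    let ?r = "basis G - basis (add_edges G {{a, b}}) - basis (add_edges G {{a, c}})
       + basis (add_edges G {{a, b}, {a, c}}) :: graph \<Rightarrow>\<^sub>0 'k"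
    have "?r \<in> modular_relations"
      unfolding modular_relations_def using abc \<open>b \<noteq> c\<close> by blast
    then have "?r \<in> ?S" by (intro graph_space.span_base) auto
    moreover have "basis (add_edges G {{a, b}}) \<in> ?S" "basis (add_edges G {{a, c}}) \<in> ?S"
      "basis (add_edges G {{a, b}, {a, c}}) \<in> ?S"
      using abc by (auto intro!: smaller pair_in_all_edges)
    ultimately have "?r + basis (add_edges G {{a, b}}) + basis (add_edges G {{a, c}})
       - basis (add_edges G {{a, b}, {a, c}}) \<in> ?S"
      by (rule graph_space.span_diff[OF graph_space.span_add[OF graph_space.span_add]])
    then show ?thesis by simp
  next
    case False
    then obtain c :: "nat \<Rightarrow> color" where c: "G = multipartite (order G) c"
      using eq_multipartite_if_nonadjacency_transitive by metis
    define m where "m = type_rep (coloring_monomial G c)"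
    obtain n' and c' :: "nat \<Rightarrow> color"
      where c': "type_graph m = multipartite n' c'" "coloring_monomial (multipartite n' c') c' = m"
      by (rule type_graphE)
    \<comment> \<open>Passing to a representative permutes the part sizes and the choice of
      \<open>type_graph\<close> relabels vertices; an isomorphism relation absorbs both.\<close>
    have "same_type (coloring_monomial G c) (coloring_monomial (multipartite n' c') c')"
      unfolding c'(2) m_def by (rule same_type_rep)
    then have "isomorphic G (type_graph m)"
      unfolding c'(1) using c isomorphic_multipartite by metis
    then have "basis G - basis (type_graph m) \<in> (isomorphism_relations :: (graph \<Rightarrow>\<^sub>0 'k) set)"
      unfolding isomorphism_relations_def by blast
    then have "basis G - basis (type_graph m) \<in> ?S" by (intro graph_space.span_base) auto
    moreover have "basis (type_graph m) \<in> ?S"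
      by (rule graph_space.span_base) (auto simp: m_def)
    ultimately have "basis G - basis (type_graph m) + basis (type_graph m) \<in> ?S"
      by (rule graph_space.span_add)
    then show ?thesis by simp
  qed
qed

lemma eq_sum_basis:
  "x = (\<Sum>G\<in>Poly_Mapping.keys x. scaleG (Poly_Mapping.lookup x G) (basis G))"
proof (rule poly_mapping_eqI)
  fix H
  have "Poly_Mapping.lookup (\<Sum>G\<in>Poly_Mapping.keys x. scaleG (Poly_Mapping.lookup x G) (basis G)) H
     = (\<Sum>G\<in>Poly_Mapping.keys x. if G = H then Poly_Mapping.lookup x G else 0)"
    unfolding lookup_sum
    by (rule sum.cong) (auto simp: lookup_scaleG basis_def lookup_single when_def)
  then show "Poly_Mapping.lookup x H
     = Poly_Mapping.lookup (\<Sum>G\<in>Poly_Mapping.keys x. scaleG (Poly_Mapping.lookup x G) (basis G)) H"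
    by (simp add: in_keys_iff)
qed

lemma graph_space_reduction:
  "x \<in> graph_space.span (relations \<union> (\<lambda>m. basis (type_graph m)) ` range type_rep)"
  by (subst eq_sum_basis)
     (intro graph_space.span_sum graph_space.span_scale basis_reduction)

section \<open>Kernel and image\<close>

interpretation chromatic: Vector_Spaces.linear scaleG scaleS
    "chromatic_map :: (graph \<Rightarrow>\<^sub>0 'k::field_char_0) \<Rightarrow> 'k series"
  by (rule linear_chromatic_map)

lemma chromatic_map_relation:
  assumes "r \<in> relations"
  shows "chromatic_map r = 0"
  using assms
proof
  assume "r \<in> modular_relations"
  then obtain G a b c where abc: "a \<in> verts G" "b \<in> verts G" "c \<in> verts G" "a \<noteq> b" "a \<noteq> c"
      "{b, c} \<in> edges G"
    and r: "r = basis G - basis (add_edges G {{a, b}}) - basis (add_edges G {{a, c}})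
      + basis (add_edges G {{a, b}, {a, c}})"
    unfolding modular_relations_def by blast
  show ?thesis
    using chromatic_function_modular[OF abc, where ?'k = 'a]
    by (simp add: r chromatic.add chromatic.diff chromatic_map_basis fun_eq_iff algebra_simps)
next
  assume "r \<in> isomorphism_relations"
  then obtain G1 G2 where "isomorphic G1 G2" "r = basis G1 - basis G2"
    by (auto simp: isomorphism_relations_def)
  then show ?thesis
    using chromatic_function_isomorphic[of G1 G2]
    by (simp add: chromatic.diff chromatic_map_basis)
qed

lemma chromatic_map_span_relations:
  "r \<in> graph_space.span relations \<Longrightarrow> chromatic_map r = 0"
  by (erule chromatic.eq_0_on_span[rotated]) (rule chromatic_map_relation)

text \<open>Among the indices with nonzero coefficient take \<open>m0\<close> with the fewest
  variables. By triangularity another term contributes at \<open>m0\<close> only if its index lies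
  in the same orbit, which distinct representatives exclude; the diagonal term remains
  alone.\<close>

lemma chromatic_functions_type_graph_independent:
  fixes a :: "monomial \<Rightarrow> 'k::field_char_0"
  assumes "finite T" "T \<subseteq> range type_rep" "m \<in> T"
    and sum: "(\<Sum>m\<in>T. scaleS (a m) (chromatic_function (type_graph m))) = 0"
  shows "a m = 0"
proof (rule ccontr)
  assume "a m \<noteq> 0"
  define m0 where "m0 = arg_min (\<lambda>m. card (Poly_Mapping.keys m)) (\<lambda>m. m \<in> T \<and> a m \<noteq> 0)"
  have m0: "m0 \<in> T" "a m0 \<noteq> 0"
    and minimal: "\<And>m'. m' \<in> T \<Longrightarrow> a m' \<noteq> 0 \<Longrightarrow>
      card (Poly_Mapping.keys m0) \<le> card (Poly_Mapping.keys m')"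
    using arg_min_nat_lemma[of "\<lambda>m. m \<in> T \<and> a m \<noteq> 0" m "\<lambda>m. card (Poly_Mapping.keys m)"]
      \<open>a m \<noteq> 0\<close> assms(3) unfolding m0_def by auto
  have zero: "a m' * chromatic_function (type_graph m') m0 = 0" if "m' \<in> T - {m0}" for m'
  proof (rule ccontr)
    assume "a m' * chromatic_function (type_graph m') m0 \<noteq> 0"
    then have "same_type m' m0"
      using that minimal[of m'] chromatic_function_type_graph_triangular[of m' m0] by auto
    then show False
      using that m0(1) assms(2) range_type_rep_unique[of m' m0] by auto
  qed
  have "(\<Sum>m\<in>T. a m * chromatic_function (type_graph m) m0) = 0"
    using fun_cong[OF sum, of m0] assms(1) by (simp add: scaleS_def sum_fun_apply)
  then have "a m0 * chromatic_function (type_graph m0) m0 = 0"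
    using zero assms(1) m0(1) by (simp add: sum.remove)
  then show False
    using m0(2) chromatic_function_type_graph_self[of m0, where ?'k = 'k] by simp
qed

text \<open>The reduction splits \<open>x\<close> into a part in the span of the relations, which
  maps to 0, and a combination of multipartite graphs, whose coefficients vanish by
  independence.\<close>

lemma kernel_chromatic_map:
  fixes x :: "graph \<Rightarrow>\<^sub>0 'k::field_char_0"
  assumes "chromatic_map x = 0"
  shows "x \<in> graph_space.span relations"
proof -
  let ?b = "\<lambda>m. basis (type_graph m) :: graph \<Rightarrow>\<^sub>0 'k"
  have "x \<in> graph_space.span (relations \<union> ?b ` range type_rep)"
    by (rule graph_space_reduction)
  then obtain r y where x: "x = r + y" and r: "r \<in> graph_space.span relations"
    and y: "y \<in> graph_space.span (?b ` range type_rep)"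
    by (auto simp: graph_space.span_Un)
  obtain B s where B: "finite B" "B \<subseteq> ?b ` range type_rep" and ys: "y = (\<Sum>v\<in>B. scaleG (s v) v)"
    using y by (auto simp: graph_space.span_explicit)
  obtain T where T: "T \<subseteq> range type_rep" "inj_on ?b T" "B = ?b ` T"
    using B(2) by (auto simp: subset_image_inj)
  have "finite T" using B(1) T by (simp add: finite_image_iff)
  have yT: "y = (\<Sum>m\<in>T. scaleG (s (?b m)) (?b m))"
    using T by (simp add: ys sum.reindex)
  have "chromatic_map y = 0"
    using assms chromatic_map_span_relations[OF r] by (simp add: x chromatic.add)
  then have "(\<Sum>m\<in>T. scaleS (s (?b m)) (chromatic_function (type_graph m))) = 0"
    by (simp add: yT chromatic.sum chromatic.scale chromatic_map_basis)
  then have "s (?b m) = 0" if "m \<in> T" for m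
    using chromatic_functions_type_graph_independent[OF \<open>finite T\<close> T(1) that,
        where a = "\<lambda>m. s (?b m)"] by simp
  then have "y = 0" by (simp add: yT)
  with r x show ?thesis by simp
qed

section \<open>The image: containment in \<open>Sym\<close> and elimination by the number of
  variables\<close>

lemma subspace_Sym: "series_space.subspace (Sym :: 'k::field_char_0 series set)"
proof (rule series_space.subspaceI)
  fix F G :: "'k series" assume F: "F \<in> Sym" and G: "G \<in> Sym"
  obtain d e where "\<forall>m. F m \<noteq> 0 \<longrightarrow> mon_degree m \<le> d" "\<forall>m. G m \<noteq> 0 \<longrightarrow> mon_degree m \<le> e"
    using F G by (auto simp: Sym_def)
  then have "\<forall>m. (F + G) m \<noteq> 0 \<longrightarrow> mon_degree m \<le> max d e"
    by (metis add.right_neutral max.coboundedI1 max.coboundedI2 plus_fun_apply)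
  then show "F + G \<in> Sym" using F G by (auto simp: Sym_def)
qed (auto simp: Sym_def scaleS_def)

lemma chromatic_function_in_Sym: "(chromatic_function G :: 'k::field_char_0 series) \<in> Sym"
  unfolding Sym_def using chromatic_function_homogeneous[of G, where ?'k = 'k]
  by (auto simp: chromatic_function_symmetric intro!: exI[of _ "order G"])

lemma chromatic_map_in_Sym: "chromatic_map x \<in> Sym"
  unfolding chromatic_map_def
  by (intro series_space.subspace_sum series_space.subspace_scale subspace_Sym
      chromatic_function_in_Sym)

text \<open>Types embed into the finitely many graphs of order at most \<open>d\<close>. If
  \<open>m\<close> and \<open>m'\<close> share a graph, its function is nonzero at both, and
  triangularity applies to whichever has at least as many variables. The field \<open>real\<close>
  is an arbitrary instance.\<close>

lemma finite_types_of_bounded_degree: "finite {m \<in> range type_rep. mon_degree m \<le> d}"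
proof -
  let ?T = "{m \<in> range type_rep. mon_degree m \<le> d}"
  have "inj_on type_graph ?T"
  proof (rule inj_onI)
    fix m m' assume m: "m \<in> ?T" "m' \<in> ?T" and eq: "type_graph m = type_graph m'"
    have "(chromatic_function (type_graph m) m' :: real) \<noteq> 0"
      "(chromatic_function (type_graph m') m :: real) \<noteq> 0"
      using chromatic_function_type_graph_self[where ?'k = real] by (metis eq)+
    then have "same_type m m' \<or> same_type m' m"
      using chromatic_function_type_graph_triangular nat_le_linear by blast
    moreover have r: "m \<in> range type_rep" "m' \<in> range type_rep"
      using m by simp_all
    ultimately show "m = m'"
      using range_type_rep_unique[OF r] range_type_rep_unique[OF r(2,1)] by metis
  qed
  moreover have "finite (type_graph ` ?T)"
  proof (rule finite_imageD)
    have bounded: "Rep_graph G \<in> {..d} \<times> Pow (all_edges d)" if "order G \<le> d" for G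
    proof -
      have "edges G \<subseteq> all_edges d"
        using edges_subset[of G] that by (fastforce simp: all_edges_def)
      then show ?thesis using that by (simp add: order_def edges_def mem_Times_iff)
    qed
    have "Rep_graph ` type_graph ` ?T \<subseteq> {..d} \<times> Pow (all_edges d)"
      unfolding image_image by (intro image_subsetI bounded) (simp add: order_type_graph)
    moreover have "finite ({..d} \<times> Pow (all_edges d))" by (simp add: all_edges_def)
    ultimately show "finite (Rep_graph ` type_graph ` ?T)" by (rule finite_subset)
  qed (auto simp: inj_on_def Rep_graph_inject)
  ultimately show ?thesis by (rule finite_imageD[rotated])
qed

lemma card_keys_le_mon_degree: "card (Poly_Mapping.keys m) \<le> mon_degree m"
proof -
  have "card (Poly_Mapping.keys m) = (\<Sum>i\<in>Poly_Mapping.keys m. 1)" by simp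
  also have "\<dots> \<le> mon_degree m"
    unfolding mon_degree_def by (rule sum_mono) (simp add: in_keys_iff Suc_le_eq)
  finally show ?thesis .
qed

text \<open>The chromatic function of \<open>type_graph m'\<close> is nonzero at \<open>m'\<close>,
  hence by symmetry at \<open>m\<close>, and it is homogeneous.\<close>

lemma mon_degree_same_type:
  assumes "same_type m m'"
  shows "mon_degree m = mon_degree m'"
proof -
  have "chromatic_function (type_graph m') m = (chromatic_function (type_graph m') m' :: real)"
    by (rule Sym_same_type[OF chromatic_function_in_Sym assms])
  then have "(chromatic_function (type_graph m') m :: real) \<noteq> 0"
    using chromatic_function_type_graph_self[of m', where ?'k = real] by simp
  then show ?thesis
    using chromatic_function_homogeneous order_type_graph by metis
qed

text \<open>Subtracting suitable multiples of the chromatic symmetric functions of complete multipartite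
  graphs clears the monomials in \<open>k\<close> variables, without creating monomials in fewer variables.\<close>

lemma Sym_subset_range:
  fixes F :: "'k::field_char_0 series"
  assumes "F \<in> Sym" "\<And>m. F m \<noteq> 0 \<Longrightarrow> mon_degree m \<le> d"
    and "\<And>m. F m \<noteq> 0 \<Longrightarrow> k \<le> card (Poly_Mapping.keys m)"
  shows "F \<in> range chromatic_map"
  using assms
proof (induction "Suc d - k" arbitrary: F k)
  case 0
  \<comment> \<open>Truncated subtraction gives \<open>k > d\<close>, and no monomial of degree at
    most \<open>d\<close> has that many variables.\<close>
  have "F m = 0" for m
    using 0(1) 0(3)[of m] 0(4)[of m] card_keys_le_mon_degree[of m] by linarith
  then have "F = chromatic_map 0" by (auto simp: fun_eq_iff chromatic.zero)
  then show ?case by blast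
next
  case (Suc j)
  define T where "T = {m \<in> {m \<in> range type_rep. mon_degree m \<le> d}. card (Poly_Mapping.keys m) = k}"
  have "finite T" unfolding T_def
    by (rule finite_subset[OF _ finite_types_of_bounded_degree[of d]]) blast
  let ?X = "\<lambda>m. chromatic_function (type_graph m) :: 'k series"
  \<comment> \<open>The term of \<open>m\<close> reproduces \<open>F\<close> at \<open>m\<close>;
    the other terms vanish there, since they belong to other orbits with the same number
    \<open>k\<close> of variables.\<close>
  define y where "y = (\<Sum>m\<in>T. scaleG (F m / ?X m m) (basis (type_graph m)))"
  define F' where "F' = F - chromatic_map y"
  have y: "chromatic_map y m' = (\<Sum>m\<in>T. F m / ?X m m * ?X m m')" for m'
    by (simp add: y_def chromatic.sum chromatic.scale chromatic_map_basis sum_fun_apply scaleS_def)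
  have F'_Sym: "F' \<in> Sym"
    unfolding F'_def using Suc.prems(1) chromatic_map_in_Sym
    by (rule series_space.subspace_diff[OF subspace_Sym])
  have zero: "F' m' = 0" if "m' \<in> T" for m'
  proof -
    have "?X m m' = 0" if "m \<in> T - {m'}" for m
      using that \<open>m' \<in> T\<close> chromatic_function_type_graph_triangular[of m m', where ?'k = 'k]
        range_type_rep_unique[of m m'] by (auto simp: T_def)
    then have "chromatic_map y m' = F m'"
      using \<open>finite T\<close> that chromatic_function_type_graph_self[of m', where ?'k = 'k]
      by (simp add: y sum.remove)
    then show ?thesis by (simp add: F'_def)
  qed
  have deg: "mon_degree m' \<le> d" and keys: "k \<le> card (Poly_Mapping.keys m')" if "F' m' \<noteq> 0" for m'
  proof -
    have "F m' \<noteq> 0 \<or> (\<exists>m\<in>T. ?X m m' \<noteq> 0)"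
    proof (rule ccontr)
      assume "\<not> ?thesis"
      then have "F m' = 0" "\<And>m. m \<in> T \<Longrightarrow> ?X m m' = 0" by auto
      then show False
        using that by (simp add: F'_def y)
    qed
    then have "mon_degree m' \<le> d \<and> k \<le> card (Poly_Mapping.keys m')"
    proof
      assume "F m' \<noteq> 0"
      then show ?thesis using Suc.prems by blast
    next
      assume "\<exists>m\<in>T. ?X m m' \<noteq> 0"
      then obtain m where m: "m \<in> T" "?X m m' \<noteq> 0" by blast
      have "mon_degree m' \<le> d"
        using m chromatic_function_homogeneous[OF m(2)] by (simp add: T_def order_type_graph)
      moreover have "k \<le> card (Poly_Mapping.keys m')"
        using m chromatic_function_type_graph_triangular[OF m(2)] same_type_card_keys[of m m']
        by (cases "card (Poly_Mapping.keys m') \<le> card (Poly_Mapping.keys m)") (auto simp: T_def)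
      ultimately show ?thesis ..
    qed
    then show "mon_degree m' \<le> d" "k \<le> card (Poly_Mapping.keys m')" by auto
  qed
  have "Suc k \<le> card (Poly_Mapping.keys m')" if "F' m' \<noteq> 0" for m'
  proof (rule ccontr)
    assume "\<not> Suc k \<le> card (Poly_Mapping.keys m')"
    then have "card (Poly_Mapping.keys m') = k" using keys[OF that] by simp
    \<comment> \<open>\<open>F'\<close> has been cleared only at representatives; its symmetry
      extends this to all monomials of degree at most \<open>d\<close> in \<open>k\<close>
      variables.\<close>
    then have "type_rep m' \<in> T"
      using deg[OF that] same_type_card_keys[OF same_type_rep] mon_degree_same_type[OF same_type_rep]
      by (simp add: T_def)
    then show False
      using zero that Sym_same_type[OF F'_Sym same_type_rep] by metis
  qed
  then have "F' \<in> range chromatic_map"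
    using Suc.hyps(2) F'_Sym deg by (intro Suc.hyps(1)[of "Suc k"]) auto
  then obtain z where "F' = chromatic_map z" by blast
  then have "F = chromatic_map (z + y)" by (simp add: F'_def chromatic.add algebra_simps)
  then show ?case by blast
qed

theorem theorem2:
  shows "{x :: graph \<Rightarrow>\<^sub>0 'k::field_char_0. chromatic_map x = 0}
           = module.span scaleG (modular_relations \<union> isomorphism_relations)
         \<and> range (chromatic_map :: (graph \<Rightarrow>\<^sub>0 'k) \<Rightarrow> 'k series) = Sym"
proof
  show "{x :: graph \<Rightarrow>\<^sub>0 'k. chromatic_map x = 0} = graph_space.span relations"
    using kernel_chromatic_map chromatic_map_span_relations by blast
  \<comment> \<open>Starting at \<open>k = 0\<close> puts no condition on the support;
    \<open>d\<close> is the degree bound in the definition of \<open>Sym\<close>.\<close>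
  have "F \<in> range chromatic_map" if "F \<in> Sym" for F :: "'k series"
    using Sym_subset_range[OF that, of _ 0] that by (auto simp: Sym_def)
  then show "range (chromatic_map :: (graph \<Rightarrow>\<^sub>0 'k) \<Rightarrow> 'k series) = Sym"
    using chromatic_map_in_Sym by blast
qed

end
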